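(* Let $n\ge 1$ be an integer and let $p,q,r,a,\alpha,\beta,\gamma,\sigma$ be real numbers such that $$p,q\ge 1,\qquad r>0,\qquad 0\le a\le 1,$$ $$\frac1p+\frac{\alpha}{n}>0,\qquad \frac1q+\frac{\beta}{n}>0,\qquad \frac1r+\frac{\gamma}{n}>0,$$ $$\gamma=a\sigma+(1-a)\beta,$$ $$\frac1r+\frac{\gamma}{n}=a\left(\frac1p+\frac{\alpha-1}{n}\right)+(1-a)\left(\frac1q+\frac{\beta}{n}\right),$$ and $$\frac{1-a}{q}\le\frac1r\le\frac{a}{p}+\frac{1-a}{q}.$$ If $a>0$, assume moreover that $$(n-1)\left[\frac1a\left(\frac1r-\frac1q\right)+\frac1q-\frac1p\right]\le\alpha-\sigma\le 0,$$ where the first (left-hand) inequality is required to be strict if $p=1$, and that $$-\frac{\sigma}{n}<\frac1a\left(\frac1r-\frac1q\right)+\frac1q.$$ Then there exists a constant $C>0$, independent of $u$, such that $$\big\||x|^{\gamma}u\big\|_{L^r(\mathbb{R}^n)}\le C\,\big\||x|^{\alpha}\nabla u\big\|_{L^p(\mathbb{R}^n)}^{a}\,\big\||x|^{\beta}u\big\|_{L^q(\mathbb{R}^n)}^{1-a}$$ for all radially symmetric $u\in C_0^\infty(\mathbb{R}^n)$.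
   Context: $C_0^\infty(\mathbb{R}^n)$ is the space of smooth compactly supported functions on $\mathbb{R}^n$. A function $u$ is radially symmetric if $u(x)$ depends only on $|x|$. $L^s(\mathbb{R}^n)$ norms are taken with respect to Lebesgue measure. *)

theory Defs
  imports "HOL-Analysis.Analysis"
begin

definition gradient :: "(real ^ 'n::finite \<Rightarrow> real) \<Rightarrow> real ^ 'n \<Rightarrow> real ^ 'n" where
  "gradient u x = (\<chi> i. frechet_derivative u (at x) (axis i 1))"

text \<open>\<open>Ck k u\<close>: \<open>u\<close> is \<open>k\<close> times continuously differentiable on the whole space.\<close>

fun Ck :: "nat \<Rightarrow> (real ^ 'n::finite \<Rightarrow> real) \<Rightarrow> bool" where
  "Ck 0 u \<longleftrightarrow> continuous_on UNIV u"
| "Ck (Suc k) u \<longleftrightarrow>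
     (\<forall>x. u differentiable (at x)) \<and> (\<forall>i. Ck k (\<lambda>x. gradient u x $ i))"

definition test_functions :: "(real ^ 'n::finite \<Rightarrow> real) set" where
  "test_functions = {u. (\<forall>k. Ck k u) \<and> compact (closure (support_on UNIV u))}"

definition radially_symmetric :: "(real ^ 'n::finite \<Rightarrow> real) \<Rightarrow> bool" where
  "radially_symmetric u \<longleftrightarrow> (\<forall>x y. norm x = norm y \<longrightarrow> u x = u y)"

text \<open>Powers of extended nonnegative reals, intended for exponents \<open>s \<ge> 0\<close> only,
  with the convention that \<open>x\<^sup>0 = 1\<close> for every \<open>x\<close> (whereas \<open>0 powr 0 = 0\<close>).\<close>

definition ennreal_powr :: "ennreal \<Rightarrow> real \<Rightarrow> ennreal" where
  "ennreal_powr x s =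
     (if s = 0 then 1 else if x = \<infinity> then \<infinity> else ennreal (enn2real x powr s))"

text \<open>The \<open>L\<^sup>s\<close> (quasi-)norm for \<open>0 < s < \<infinity>\<close>; it takes the value \<open>\<infinity>\<close> when the
  integral diverges.\<close>

definition Lp_norm :: "real \<Rightarrow> ('a::euclidean_space \<Rightarrow> 'b::real_normed_vector) \<Rightarrow> ennreal" where
  "Lp_norm s f = ennreal_powr (\<integral>\<^sup>+ x. ennreal (norm (f x) powr s) \<partial>lborel) (1 / s)"

end

theory Submission
  imports Defs
begin

text \<open>
  Write \<open>d = \<alpha> - 1 + n / p\<close>. For \<open>a > 0\<close> the two
  identities for \<open>\<gamma>\<close> and the last hypothesis make \<open>d\<close> positive; \<open>a = 0\<close> forces \<open>\<gamma> = \<beta>\<close> and \<open>r = q\<close>.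
  In polar coordinates a radial \<open>u\<close> satisfies \<open>\<bar>u(s)\<bar> \<le> \<integral>\<^bsub>s\<^esub>\<^sup>\<infinity> \<bar>u'(t)\<bar> dt\<close>, and Jensen's inequality
  for the probability measure \<open>d s\<^sup>d t powr (-1 - d) dt\<close> on \<open>[s, \<infinity>)\<close> bounds \<open>\<bar>u(s)\<bar> powr p\<close>
  by a weighted integral of \<open>\<bar>u'\<bar> powr p\<close>. This yields both a decay estimate for
  \<open>\<bar>x\<bar> powr d * \<bar>u\<bar>\<close> and a Hardy inequality, each in terms of the weighted \<open>L\<^sup>p\<close> norm of the
  gradient. The theorem follows by writing \<open>(\<bar>x\<bar> powr \<gamma> * \<bar>u\<bar>) powr r\<close> as a product of powers
  of the two quantities bounded in this way and of \<open>(\<bar>x\<bar> powr \<beta> * \<bar>u\<bar>) powr q\<close>, and applying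
  Hoelder's inequality.
\<close>

section \<open>Young's and Hoelder's inequalities in weighted form\<close>

text \<open>The weighted arithmetic-geometric mean inequality. Vanishing arguments are harmless:
  \<open>0 powr s = 0\<close> for every \<open>s\<close>, even \<open>s = 0\<close>, so the left
  side is then 0.\<close>

lemma powr_mult_powr_le:
  fixes x y t :: real
  assumes "0 \<le> x" "0 \<le> y" "0 \<le> t" "t \<le> 1"
  shows "x powr (1 - t) * y powr t \<le> (1 - t) * x + t * y"
proof (cases "x = 0 \<or> y = 0")
  case True
  with assms show ?thesis by auto
next
  case False
  with assms show ?thesis
    using Youngs_inequality_0[of "1 - t" t x y] by simp
qed

text \<open>Hoelder's inequality with exponents \<open>1 / (1 - t)\<close> and \<open>1 / t\<close>,
  by integrating Young's inequality for the normalised values \<open>f x / A\<close> and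
  \<open>g x / B\<close>. The bound by \<open>B\<close> is asked for only if \<open>t > 0\<close>,
  so that for \<open>t = 0\<close> the integral of \<open>g\<close> may be infinite.\<close>

lemma nn_integral_powr_mult_le:
  fixes f g :: "'a \<Rightarrow> real"
  assumes meas: "f \<in> borel_measurable M" "g \<in> borel_measurable M"
    and nonneg: "\<And>x. 0 \<le> f x" "\<And>x. 0 \<le> g x"
    and t: "0 \<le> t" "t \<le> 1" and AB: "0 < A" "0 < B"
    and f: "(\<integral>\<^sup>+x. f x \<partial>M) \<le> ennreal A"
    and g: "t > 0 \<Longrightarrow> (\<integral>\<^sup>+x. g x \<partial>M) \<le> ennreal B"
  shows "(\<integral>\<^sup>+x. f x powr (1 - t) * g x powr t \<partial>M) \<le> ennreal (A powr (1 - t) * B powr t)"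
proof -
  define K where "K = A powr (1 - t) * B powr t"
  have K: "K \<ge> 0" by (simp add: K_def)
  have "f x powr (1 - t) * g x powr t \<le> K * ((1 - t) / A * f x + t / B * g x)" for x
  proof -
    have "f x powr (1 - t) * g x powr t = K * ((f x / A) powr (1 - t) * (g x / B) powr t)"
      using AB nonneg by (simp add: K_def powr_divide)
    also have "\<dots> \<le> K * ((1 - t) * (f x / A) + t * (g x / B))"
      using AB nonneg t K by (intro mult_left_mono powr_mult_powr_le) auto
    finally show ?thesis by simp
  qed
  then have "(\<integral>\<^sup>+x. f x powr (1 - t) * g x powr t \<partial>M)
      \<le> (\<integral>\<^sup>+x. ennreal (K * ((1 - t) / A * f x + t / B * g x)) \<partial>M)"
    by (intro nn_integral_mono ennreal_leI)
  also have "\<dots> = (\<integral>\<^sup>+x. ennreal K * (ennreal ((1 - t) / A) * ennreal (f x) + ennreal (t / B) * ennreal (g x)) \<partial>M)"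
    using K AB t nonneg by (intro nn_integral_cong) (simp add: ennreal_mult ennreal_plus del: times_divide_eq_left)
  also have "\<dots> = ennreal K * (ennreal ((1 - t) / A) * (\<integral>\<^sup>+x. f x \<partial>M) + ennreal (t / B) * (\<integral>\<^sup>+x. g x \<partial>M))"
    using meas by (simp add: nn_integral_cmult nn_integral_add)
  also have "\<dots> \<le> ennreal K * (ennreal (1 - t) + ennreal t)"
  proof (intro mult_left_mono add_mono)
    have "ennreal ((1 - t) / A) * (\<integral>\<^sup>+x. f x \<partial>M) \<le> ennreal ((1 - t) / A) * ennreal A"
      by (intro mult_left_mono f) auto
    also have "\<dots> = ennreal (1 - t)"
      using AB t by (simp flip: ennreal_mult)
    finally show "ennreal ((1 - t) / A) * (\<integral>\<^sup>+x. f x \<partial>M) \<le> ennreal (1 - t)" .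
    show "ennreal (t / B) * (\<integral>\<^sup>+x. g x \<partial>M) \<le> ennreal t"
    \<comment> \<open>For \<open>t = 0\<close> the coefficient \<open>t / B\<close> is 0 and
      annihilates even an infinite integral.\<close>
    proof (cases "t = 0")
      case False
      then have "ennreal (t / B) * (\<integral>\<^sup>+x. g x \<partial>M) \<le> ennreal (t / B) * ennreal B"
        using t by (intro mult_left_mono g) auto
      also have "\<dots> = ennreal t"
        using AB t by (simp flip: ennreal_mult)
      finally show ?thesis .
    qed simp
  qed simp_all
  also have "\<dots> = ennreal K" using t by (simp flip: ennreal_plus)
  finally show ?thesis unfolding K_def .
qed

section \<open>Polar coordinates for radial integrands\<close>

text \<open>Both measures give \<open>{..x}\<close> the volume of the ball of radius
  \<open>x\<close>, or 0 if \<open>x < 0\<close>. These half-lines are closed under intersection,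
  generate the Borel sets and exhaust the line with finite measure, so the measures agree.\<close>

lemma distr_norm_lborel:
  "distr lborel borel (norm :: 'a::euclidean_space \<Rightarrow> real) =
    density lborel (\<lambda>t. ennreal (real DIM('a) * unit_ball_vol (real DIM('a)) * t ^ (DIM('a) - 1)) * indicator {0..} t)"
    (is "?M = ?N")
proof (rule measure_eqI_generator_eq[where E = "range atMost" and \<Omega> = UNIV and A = "\<lambda>i::nat. {..real i}"])
  let ?w = "unit_ball_vol (real DIM('a))"
  have vM: "emeasure ?M {..x} = ennreal (if x < 0 then 0 else ?w * x ^ DIM('a))" for x
  proof -
    have "norm -` {..x} = (if x < 0 then {} else cball (0::'a) x)"
      by (auto dest: order.trans[OF norm_ge_zero])
    then have "emeasure ?M {..x} = emeasure lborel (if x < 0 then {} else cball (0::'a) x)"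
      by (simp add: emeasure_distr)
    then show ?thesis by (simp add: emeasure_cball)
  qed
  have vN: "emeasure ?N {..x} = ennreal (if x < 0 then 0 else ?w * x ^ DIM('a))" for x
  proof -
    have "emeasure ?N {..x} = (\<integral>\<^sup>+t. ennreal (real DIM('a) * ?w * t ^ (DIM('a) - 1)) * indicator {0..x} t \<partial>lborel)"
      by (subst emeasure_density) (auto intro!: nn_integral_cong split: split_indicator)
    also have "\<dots> = ennreal (if x < 0 then 0 else ?w * x ^ DIM('a))"
    proof (cases "x < 0")
      case False
      have "(\<integral>\<^sup>+t. ennreal (real DIM('a) * ?w * t ^ (DIM('a) - 1)) * indicator {0..x} t \<partial>lborel)
         = ?w * x ^ DIM('a) - ?w * 0 ^ DIM('a)"
        using False by (intro nn_integral_FTC_Icc) (auto intro!: derivative_eq_intros)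
      with False show ?thesis by simp
    qed simp
    finally show ?thesis .
  qed
  show "emeasure ?M X = emeasure ?N X" if "X \<in> range atMost" for X
    using that vM vN by auto
  show "emeasure ?M {..real i} \<noteq> \<infinity>" for i
    by (simp add: vM)
  show "Int_stable (range (atMost :: real \<Rightarrow> _))"
    by (auto simp: Int_stable_def)
  show "(\<Union>i::nat. {..real i}) = UNIV"
    by (auto intro: real_arch_simple)
qed (auto simp: borel_eq_atMost)

text \<open>The density is written with \<open>powr\<close> so that it merges with weights of real
  exponent.\<close>

lemma nn_integral_radial:
  fixes g :: "real \<Rightarrow> ennreal"
  assumes [measurable]: "g \<in> borel_measurable borel"
  shows "(\<integral>\<^sup>+x. g (norm (x::'a::euclidean_space)) \<partial>lborel) =
    ennreal (real DIM('a) * unit_ball_vol (real DIM('a))) *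
      (\<integral>\<^sup>+t. ennreal (t powr (real DIM('a) - 1)) * g t * indicator {0<..} t \<partial>lborel)"
proof -
  let ?c = "real DIM('a) * unit_ball_vol (real DIM('a))"
  have "(\<integral>\<^sup>+x. g (norm (x::'a)) \<partial>lborel) = (\<integral>\<^sup>+t. g t \<partial>distr lborel borel (norm :: 'a \<Rightarrow> real))"
    by (simp add: nn_integral_distr)
  also have "\<dots> = (\<integral>\<^sup>+t. (ennreal (?c * t ^ (DIM('a) - 1)) * indicator {0..} t) * g t \<partial>lborel)"
    unfolding distr_norm_lborel by (subst nn_integral_density) auto
  also have "\<dots> = (\<integral>\<^sup>+t. ennreal ?c * (ennreal (t powr (real DIM('a) - 1)) * g t * indicator {0<..} t) \<partial>lborel)"
  \<comment> \<open>At \<open>t = 0\<close> the sides may differ: in dimension 1,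
    \<open>t ^ 0 = 1\<close> there, while the indicator of \<open>{0<..}\<close> is 0.\<close>
  proof (rule nn_integral_cong_AE)
    have "AE t in lborel. t \<noteq> (0::real)"
      by (rule AE_lborel_singleton)
    then show "AE t in lborel. (ennreal (?c * t ^ (DIM('a) - 1)) * indicator {0..} t) * g t
        = ennreal ?c * (ennreal (t powr (real DIM('a) - 1)) * g t * indicator {0<..} t)"
    proof eventually_elim
      case (elim t)
      have "t > 0 \<Longrightarrow> t ^ (DIM('a) - 1) = t powr (real DIM('a) - 1)"
        by (simp flip: powr_realpow add: of_nat_diff Suc_leI)
      with elim show ?case
        by (auto simp: ennreal_mult mult_ac split: split_indicator)
    qed
  qed
  also have "\<dots> = ennreal ?c * (\<integral>\<^sup>+t. ennreal (t powr (real DIM('a) - 1)) * g t * indicator {0<..} t \<partial>lborel)"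
    by (rule nn_integral_cmult) measurable
  finally show ?thesis .
qed

section \<open>Hardy inequalities on the half-line\<close>

text \<open>\<open>F\<close> stands for the modulus of a function at radius \<open>s\<close>, and
  \<open>h\<close> for the modulus of its derivative. The integral on the right stays over
  \<open>{s..}\<close>: estimating its integrand yields the decay estimate, and integrating in
  \<open>s\<close> yields the Hardy inequality.\<close>

lemma hardy_pointwise:
  fixes h :: "real \<Rightarrow> real"
  assumes [measurable]: "h \<in> borel_measurable borel" and h: "\<And>t. 0 \<le> h t"
    and p: "1 \<le> p" and d: "0 < d" and s: "0 < s" and F0: "0 \<le> F"
    and F: "ennreal F \<le> (\<integral>\<^sup>+t. ennreal (h t) * indicator {s..} t \<partial>lborel)"
  shows "ennreal (F powr p) \<le> ennreal (d powr (1 - p) * s powr (d * (1 - p))) *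
      (\<integral>\<^sup>+t. ennreal (h t powr p * t powr ((1 + d) * (p - 1))) * indicator {s..} t \<partial>lborel)"
proof (cases "F = 0")
  case False
  with F0 have Fpos: "F > 0" by simp
  \<comment> \<open>Instead of Jensen's inequality, integrate the tangent inequality for \<open>w powr p\<close> at \<open>w = F\<close>;
    this needs no integrability, only that \<open>\<nu>\<close> has mass \<open>1\<close> on \<open>{s..}\<close>.\<close>
  define \<nu> where "\<nu> t = d * s powr d * t powr (-1 - d)" for t
  define c where "c = d powr (1 - p) * s powr (d * (1 - p))"
  define k where "k t = h t powr p * t powr ((1 + d) * (p - 1))" for t
  have [measurable]: "k \<in> borel_measurable borel" "\<nu> \<in> borel_measurable borel"
    unfolding k_def[abs_def] \<nu>_def[abs_def] by measurable
  have mass: "(\<integral>\<^sup>+t. ennreal (\<nu> t) * indicator {s..} t \<partial>lborel) = 1"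
  proof -
    have "(\<integral>\<^sup>+t. ennreal (\<nu> t) * indicator {s..} t \<partial>lborel) = 0 - (- (s powr d * s powr (-d)))"
    proof (rule nn_integral_FTC_atLeast[where F = "\<lambda>t. - (s powr d * t powr (-d))"])
      show "((\<lambda>t. - (s powr d * t powr (-d))) has_real_derivative \<nu> t) (at t)" if "s \<le> t" for t
        using that s unfolding \<nu>_def
        by (auto intro!: derivative_eq_intros simp: powr_diff powr_minus field_simps)
      have "((\<lambda>t. t powr (-d)) \<longlongrightarrow> 0) at_top"
        using d by (intro tendsto_neg_powr filterlim_ident) auto
      then show "((\<lambda>t. - (s powr d * t powr (-d))) \<longlongrightarrow> 0) at_top"
        using tendsto_minus[OF tendsto_mult_right_zero[of "\<lambda>t. t powr (-d)" at_top "s powr d"]] by simp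
    qed (use d in \<open>auto simp: \<nu>_def\<close>)
    also have "s powr d * s powr (-d) = 1" using s by (simp flip: powr_add)
    finally show ?thesis by simp
  qed
  have pt: "p * F powr (p - 1) * h t \<le> c * k t + (p - 1) * F powr p * \<nu> t" if t: "s \<le> t" for t
  proof -
    have t0: "t > 0" using t s by simp
    define w where "w = h t / \<nu> t"
    have nu: "\<nu> t > 0" using d s t0 by (simp add: \<nu>_def)
    have w0: "w \<ge> 0" using nu h by (simp add: w_def)
    \<comment> \<open>Young's inequality with weight \<open>1 / p\<close>, multiplied by
      \<open>p\<close>, is the tangent inequality for the power \<open>p\<close>. Taken at
      \<open>w = h t / \<nu> t\<close> and multiplied by \<open>\<nu> t\<close>, it becomes the
      claim.\<close>
    have "(F powr p) powr (1 - 1/p) * (w powr p) powr (1/p) \<le> (1 - 1/p) * F powr p + (1/p) * w powr p"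
      using p by (intro powr_mult_powr_le) auto
    moreover have "(F powr p) powr (1 - 1/p) = F powr (p - 1)" "(w powr p) powr (1/p) = w"
      using p w0 by (auto simp: powr_powr algebra_simps)
    ultimately have "p * (F powr (p - 1) * w) \<le> p * ((1 - 1/p) * F powr p + (1/p) * w powr p)"
      using p by (intro mult_left_mono) auto
    also have "\<dots> = (p - 1) * F powr p + w powr p" using p by (simp add: field_simps)
    finally have "p * (F powr (p - 1) * w) * \<nu> t \<le> ((p - 1) * F powr p + w powr p) * \<nu> t"
      using nu by (intro mult_right_mono) auto
    also have "\<dots> = w powr p * \<nu> t + (p - 1) * F powr p * \<nu> t" by (simp add: algebra_simps)
    finally have "p * (F powr (p - 1) * w) * \<nu> t \<le> \<dots>" .
    moreover have "p * (F powr (p - 1) * w) * \<nu> t = p * F powr (p - 1) * h t"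
      using nu by (simp add: w_def)
    moreover have "w powr p * \<nu> t = c * k t"
    proof -
      have "w powr p * \<nu> t = h t powr p * (\<nu> t powr (1 - p))"
        using nu h by (simp add: w_def powr_divide powr_diff)
      also have "\<nu> t powr (1 - p) = d powr (1-p) * s powr (d * (1 - p)) * t powr ((-1 - d) * (1 - p))"
        using d s t0 by (simp add: \<nu>_def powr_mult powr_powr)
      also have "(-1 - d) * (1 - p) = (1 + d) * (p - 1)" by (simp add: algebra_simps)
      finally show ?thesis by (simp add: c_def k_def)
    qed
    ultimately show ?thesis by simp
  qed
  let ?J = "\<integral>\<^sup>+t. ennreal (k t) * indicator {s..} t \<partial>lborel"
  have "ennreal (p * F powr (p - 1)) * ennreal F
      \<le> ennreal (p * F powr (p - 1)) * (\<integral>\<^sup>+t. ennreal (h t) * indicator {s..} t \<partial>lborel)"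
    by (intro mult_left_mono F) auto
  also have "\<dots> = (\<integral>\<^sup>+t. ennreal (p * F powr (p - 1) * h t) * indicator {s..} t \<partial>lborel)"
    using p h by (subst nn_integral_cmult[symmetric]) (auto simp: ennreal_mult mult_ac)
  also have "\<dots> \<le> (\<integral>\<^sup>+t. ennreal c * (ennreal (k t) * indicator {s..} t) +
        ennreal ((p - 1) * F powr p) * (ennreal (\<nu> t) * indicator {s..} t) \<partial>lborel)"
  proof (intro nn_integral_mono)
    fix t
    have nn: "c \<ge> 0" "k t \<ge> 0" "\<nu> t \<ge> 0" using d h by (auto simp: c_def k_def \<nu>_def)
    then show "ennreal (p * F powr (p - 1) * h t) * indicator {s..} t \<le>
       ennreal c * (ennreal (k t) * indicator {s..} t) +
        ennreal ((p - 1) * F powr p) * (ennreal (\<nu> t) * indicator {s..} t)"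
      using pt[of t] p
      by (auto split: split_indicator simp flip: ennreal_mult ennreal_plus intro!: ennreal_leI)
  qed
  also have "\<dots> = ennreal c * ?J + ennreal ((p - 1) * F powr p)"
    by (simp add: nn_integral_add nn_integral_cmult mass)
  \<comment> \<open>The second summand is the contribution of the total mass of
    \<open>\<nu>\<close>. It is finite, so it cancels even if \<open>?J\<close> is infinite.\<close>
  also have "ennreal (p * F powr (p - 1)) * ennreal F = ennreal (F powr p) + ennreal ((p - 1) * F powr p)"
    using p Fpos by (simp add: powr_diff algebra_simps flip: ennreal_mult ennreal_plus)
  finally show ?thesis
    unfolding c_def k_def using ennreal_add_left_cancel_le by (simp add: add.commute)
qed simp

text \<open>On \<open>{s..}\<close> the factor \<open>t powr (-d)\<close> is at most
  \<open>s powr (-d)\<close>. Taking it out of the pointwise bound leaves a weight independent of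
  \<open>s\<close>, and the remaining powers of \<open>s\<close> cancel because
  \<open>d * p + d * (1 - p) - d = 0\<close>.\<close>

lemma hardy_sup:
  fixes h :: "real \<Rightarrow> real"
  assumes [measurable]: "h \<in> borel_measurable borel" and h: "\<And>t. 0 \<le> h t"
    and p: "1 \<le> p" and d: "0 < d" and s: "0 < s" and F0: "0 \<le> F"
    and F: "ennreal F \<le> (\<integral>\<^sup>+t. ennreal (h t) * indicator {s..} t \<partial>lborel)"
  shows "ennreal (F powr p * s powr (d * p)) \<le> ennreal (d powr (1 - p)) *
      (\<integral>\<^sup>+t. ennreal (h t powr p * t powr ((1 + d) * p - 1)) * indicator {0<..} t \<partial>lborel)"
    (is "_ \<le> _ * ?N")
proof -
  have "(\<integral>\<^sup>+t. ennreal (h t powr p * t powr ((1 + d) * (p - 1))) * indicator {s..} t \<partial>lborel)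
      \<le> (\<integral>\<^sup>+t. ennreal (s powr (-d)) * (ennreal (h t powr p * t powr ((1 + d) * p - 1)) * indicator {0<..} t) \<partial>lborel)"
  proof (rule nn_integral_mono)
    fix t
    show "ennreal (h t powr p * t powr ((1 + d) * (p - 1))) * indicator {s..} t
      \<le> ennreal (s powr (-d)) * (ennreal (h t powr p * t powr ((1 + d) * p - 1)) * indicator {0<..} t)"
    proof (cases "s \<le> t")
      case True
      have "h t powr p * t powr ((1 + d) * (p - 1)) = t powr (-d) * (h t powr p * t powr ((1 + d) * p - 1))"
        by (simp add: algebra_simps flip: powr_add)
      also have "\<dots> \<le> s powr (-d) * (h t powr p * t powr ((1 + d) * p - 1))"
        using True s d by (intro mult_right_mono powr_mono2') auto
      finally show ?thesis using True s by (simp flip: ennreal_mult add: ennreal_leI)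
    qed simp
  qed
  also have "\<dots> = ennreal (s powr (-d)) * ?N"
    by (rule nn_integral_cmult) measurable
  finally have *: "(\<integral>\<^sup>+t. ennreal (h t powr p * t powr ((1 + d) * (p - 1))) * indicator {s..} t \<partial>lborel)
      \<le> ennreal (s powr (-d)) * ?N" .
  have "ennreal (F powr p * s powr (d * p)) = ennreal (s powr (d * p)) * ennreal (F powr p)"
    by (simp add: ennreal_mult mult.commute)
  also have "\<dots> \<le> ennreal (s powr (d * p)) *
      (ennreal (d powr (1 - p) * s powr (d * (1 - p))) * (ennreal (s powr (-d)) * ?N))"
    by (intro mult_left_mono order.trans[OF hardy_pointwise[OF assms] mult_left_mono[OF *]]) auto
  also have "\<dots> = ennreal (d powr (1 - p) * (s powr (d * p) * s powr (d * (1 - p)) * s powr (-d))) * ?N"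
    by (simp add: ennreal_mult mult_ac)
  also have "s powr (d * p) * s powr (d * (1 - p)) * s powr (-d) = 1"
    using s by (simp add: algebra_simps flip: powr_add)
  finally show ?thesis by simp
qed

text \<open>The inner integral in the proof of the Hardy inequality. For \<open>d < 1\<close> the
  integrand is singular at 0.\<close>

lemma nn_integral_powr_Icc_0:
  fixes d :: real
  assumes "0 < d" "0 \<le> t"
  shows "(\<integral>\<^sup>+s. ennreal (s powr (d - 1)) * indicator {0..t} s \<partial>lborel) = ennreal (t powr d / d)"
proof -
  have "((\<lambda>s. if s \<in> {0..t} then s powr (d - 1) else 0) has_integral (t powr (d - 1 + 1) / (d - 1 + 1))) UNIV"
    unfolding has_integral_restrict_UNIV using assms by (intro has_integral_powr_from_0) auto
  then have I: "((\<lambda>s. s powr (d - 1) * indicator {0..t} s) has_integral (t powr d / d)) UNIV"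
    by (simp add: indicator_def of_bool_def if_distrib[of "(*) _"] cong: if_cong)
  have "(\<integral>\<^sup>+s. ennreal (s powr (d - 1)) * indicator {0..t} s \<partial>lborel)
      = (\<integral>\<^sup>+s. ennreal (s powr (d - 1) * indicator {0..t} s) \<partial>lborel)"
    by (intro nn_integral_cong) (simp split: split_indicator)
  also have "\<dots> = ennreal (t powr d / d)"
    by (rule nn_integral_has_integral_lborel[OF _ _ I]) auto
  finally show ?thesis .
qed

text \<open>Multiplying the pointwise bound by \<open>s powr (d * p - 1)\<close> leaves the factor
  \<open>s powr (d - 1)\<close>. Tonelli's theorem on the region \<open>0 < s \<le> t\<close> then
  turns it into \<open>t powr d / d\<close>, which completes the weight and changes the constant
  \<open>d powr (1 - p)\<close> to \<open>d powr (-p)\<close>.\<close>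

lemma hardy_integral:
  fixes h F :: "real \<Rightarrow> real"
  assumes [measurable]: "h \<in> borel_measurable borel" "F \<in> borel_measurable borel" 
    and h: "\<And>t. 0 \<le> h t" and F0: "\<And>t. 0 \<le> F t"
    and p: "1 \<le> p" and d: "0 < d"
    and F: "\<And>s. 0 < s \<Longrightarrow> ennreal (F s) \<le> (\<integral>\<^sup>+t. ennreal (h t) * indicator {s..} t \<partial>lborel)"
  shows "(\<integral>\<^sup>+s. ennreal (F s powr p * s powr (d * p - 1)) * indicator {0<..} s \<partial>lborel) \<le> ennreal (d powr (-p)) *
      (\<integral>\<^sup>+t. ennreal (h t powr p * t powr ((1 + d) * p - 1)) * indicator {0<..} t \<partial>lborel)"
proof -
  define k where "k t = ennreal (h t powr p * t powr ((1 + d) * (p - 1)))" for t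
  have [measurable]: "k \<in> borel_measurable borel" unfolding k_def[abs_def] by measurable
  define c where "c = ennreal (d powr (1 - p))"
  have "(\<integral>\<^sup>+s. ennreal (F s powr p * s powr (d * p - 1)) * indicator {0<..} s \<partial>lborel)
     \<le> (\<integral>\<^sup>+s. c * (\<integral>\<^sup>+t. ennreal (s powr (d - 1)) * k t * (indicator {0<..} s * indicator {s..} t) \<partial>lborel) \<partial>lborel)"
  proof (rule nn_integral_mono)
    fix s :: real
    show "ennreal (F s powr p * s powr (d * p - 1)) * indicator {0<..} s
      \<le> c * (\<integral>\<^sup>+t. ennreal (s powr (d - 1)) * k t * (indicator {0<..} s * indicator {s..} t) \<partial>lborel)"
    proof (cases "s > 0")
      case True
      have "ennreal (F s powr p * s powr (d * p - 1)) = ennreal (s powr (d * p - 1)) * ennreal (F s powr p)"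
        by (simp add: ennreal_mult mult.commute)
      also have "\<dots> \<le> ennreal (s powr (d * p - 1)) * (ennreal (d powr (1 - p) * s powr (d * (1 - p))) *
          (\<integral>\<^sup>+t. k t * indicator {s..} t \<partial>lborel))"
        unfolding k_def
        by (intro mult_left_mono hardy_pointwise F) (use p d True h F0 in auto)
      also have "\<dots> = c * (ennreal (s powr (d * p - 1) * s powr (d * (1 - p))) * (\<integral>\<^sup>+t. k t * indicator {s..} t \<partial>lborel))"
        by (simp add: c_def ennreal_mult mult_ac)
      also have "s powr (d * p - 1) * s powr (d * (1 - p)) = s powr (d - 1)"
        by (simp add: algebra_simps flip: powr_add)
      also have "ennreal (s powr (d - 1)) * (\<integral>\<^sup>+t. k t * indicator {s..} t \<partial>lborel)
         = (\<integral>\<^sup>+t. ennreal (s powr (d - 1)) * k t * (indicator {0<..} s * indicator {s..} t) \<partial>lborel)"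
        using True by (simp add: mult.assoc nn_integral_cmult)
      finally show ?thesis using True by simp
    qed simp
  qed
  also have "\<dots> = c * (\<integral>\<^sup>+s. (\<integral>\<^sup>+t. ennreal (s powr (d - 1)) * k t * (indicator {0<..} s * indicator {s..} t) \<partial>lborel) \<partial>lborel)"
    by (rule nn_integral_cmult) (auto simp: indicator_def)
  also have "(\<integral>\<^sup>+s. (\<integral>\<^sup>+t. ennreal (s powr (d - 1)) * k t * (indicator {0<..} s * indicator {s..} t) \<partial>lborel) \<partial>lborel)
     = (\<integral>\<^sup>+t. (\<integral>\<^sup>+s. ennreal (s powr (d - 1)) * k t * (indicator {0<..} s * indicator {s..} t) \<partial>lborel) \<partial>lborel)"
    by (rule lborel_pair.Fubini') (auto simp: indicator_def case_prod_unfold)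
  also have "\<dots> \<le> (\<integral>\<^sup>+t. ennreal (1 / d) * (ennreal (h t powr p * t powr ((1 + d) * p - 1)) * indicator {0<..} t) \<partial>lborel)"
  proof (rule nn_integral_mono)
    fix t :: real
    show "(\<integral>\<^sup>+s. ennreal (s powr (d - 1)) * k t * (indicator {0<..} s * indicator {s..} t) \<partial>lborel)
       \<le> ennreal (1 / d) * (ennreal (h t powr p * t powr ((1 + d) * p - 1)) * indicator {0<..} t)"
    proof (cases "t > 0")
      case True
      have "(\<integral>\<^sup>+s. ennreal (s powr (d - 1)) * k t * (indicator {0<..} s * indicator {s..} t) \<partial>lborel)
         \<le> (\<integral>\<^sup>+s. k t * (ennreal (s powr (d - 1)) * indicator {0..t} s) \<partial>lborel)"
        by (intro nn_integral_mono) (auto simp: mult_ac split: split_indicator)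
      also have "\<dots> = k t * ennreal (t powr d / d)"
        using True d by (simp add: nn_integral_cmult nn_integral_powr_Icc_0)
      also have "\<dots> = ennreal (1 / d) * ennreal (h t powr p * (t powr ((1 + d) * (p - 1)) * t powr d))"
        using d unfolding k_def by (simp add: mult_ac flip: ennreal_mult)
      also have "t powr ((1 + d) * (p - 1)) * t powr d = t powr ((1 + d) * p - 1)"
        by (simp add: algebra_simps flip: powr_add)
      finally show ?thesis using True by simp
    next
      case False
      then have "(\<integral>\<^sup>+s. ennreal (s powr (d - 1)) * k t * (indicator {0<..} s * indicator {s..} t) \<partial>lborel)
         = (\<integral>\<^sup>+s. 0 \<partial>(lborel::real measure))"
        by (intro nn_integral_cong) (auto split: split_indicator)
      then show ?thesis by simp
    qed
  qed
  also have "\<dots> = ennreal (1 / d) * (\<integral>\<^sup>+t. ennreal (h t powr p * t powr ((1 + d) * p - 1)) * indicator {0<..} t \<partial>lborel)"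
    by (rule nn_integral_cmult) measurable
  also have "c * (ennreal (1 / d) * (\<integral>\<^sup>+t. ennreal (h t powr p * t powr ((1 + d) * p - 1)) * indicator {0<..} t \<partial>lborel))
     = ennreal (d powr (-p)) * (\<integral>\<^sup>+t. ennreal (h t powr p * t powr ((1 + d) * p - 1)) * indicator {0<..} t \<partial>lborel)"
    using d unfolding c_def by (simp add: powr_diff powr_minus field_simps flip: ennreal_mult mult.assoc)
  finally show ?thesis by (simp add: mult_left_mono)
qed

section \<open>Test functions and their derivatives along rays\<close>

lemma frechet_derivative_eq_gradient:
  assumes "u differentiable (at x)"
  shows "frechet_derivative u (at x) v = gradient u x \<bullet> v"
proof -
  interpret linear "frechet_derivative u (at x)"
    using assms by (rule linear_frechet_derivative)
  have "frechet_derivative u (at x) v = frechet_derivative u (at x) (\<Sum>i\<in>UNIV. v $ i *\<^sub>R axis i 1)"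
    by (simp add: basis_expansion flip: scalar_mult_eq_scaleR)
  also have "\<dots> = gradient u x \<bullet> v"
    by (simp add: sum scale inner_vec_def gradient_def mult.commute)
  finally show ?thesis .
qed

lemma test_functions_differentiable:
  assumes "u \<in> test_functions"
  shows "u differentiable (at x)"
proof -
  have "Ck (Suc 0) u" using assms unfolding test_functions_def by blast
  then show ?thesis by simp
qed

lemma test_functions_continuous_gradient:
  assumes "u \<in> test_functions"
  shows "continuous_on UNIV (gradient u)"
proof -
  have "Ck (Suc 0) u" using assms unfolding test_functions_def by blast
  then have "continuous_on UNIV (\<lambda>x. \<chi> i. gradient u x $ i)"
    by (intro continuous_on_vec_lambda) auto
  then show ?thesis by simp
qed

lemma test_functions_continuous:
  assumes "u \<in> test_functions"
  shows "continuous_on UNIV u"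
  using assms unfolding test_functions_def by (auto dest: spec[of _ 0])

lemma test_functions_bounded_support:
  assumes "u \<in> test_functions"
  obtains R where "R > 0" "\<And>x. norm x > R \<Longrightarrow> u x = 0"
proof -
  have "bounded (support_on UNIV u)"
    using assms bounded_subset[OF compact_imp_bounded closure_subset]
    unfolding test_functions_def by blast
  then obtain R where "R > 0" "\<And>x. x \<in> support_on UNIV u \<Longrightarrow> norm x \<le> R"
    unfolding bounded_pos by auto
  with that[of R] show thesis by (force simp: support_on_def)
qed

lemma DERIV_along_ray:
  fixes u :: "real ^ 'n::finite \<Rightarrow> real"
  assumes "u \<in> test_functions"
  shows "((\<lambda>t. u (t *\<^sub>R v)) has_real_derivative gradient u (t *\<^sub>R v) \<bullet> v) (at t)"
proof -
  have "(u has_derivative (\<lambda>w. gradient u (t *\<^sub>R v) \<bullet> w)) (at (t *\<^sub>R v))"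
    using iffD1[OF frechet_derivative_works test_functions_differentiable[OF assms]]
    by (simp flip: frechet_derivative_eq_gradient[OF test_functions_differentiable[OF assms]])
  then have "((\<lambda>t. u (t *\<^sub>R v)) has_derivative (\<lambda>s. gradient u (t *\<^sub>R v) \<bullet> (s *\<^sub>R v))) (at t)"
    by (rule has_derivative_compose[rotated]) (auto intro!: derivative_eq_intros)
  then show ?thesis
    by (simp add: has_field_derivative_def mult_commute_abs)
qed

text \<open>A radial function has the same profile on every ray, so its derivative along
  \<open>e\<close> at radius \<open>norm x\<close> is the one along
  \<open>x /\<^sub>R norm x\<close> at \<open>x\<close>. The Cauchy-Schwarz inequality bounds the
  latter.\<close>

lemma radial_derivative_le_gradient:
  fixes u :: "real ^ 'n::finite \<Rightarrow> real"
  assumes u: "u \<in> test_functions" and rad: "radially_symmetric u" and e: "norm e = 1" and x: "x \<noteq> 0"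
  shows "\<bar>gradient u (norm x *\<^sub>R e) \<bullet> e\<bar> \<le> norm (gradient u x)"
proof -
  define v where "v = x /\<^sub>R norm x"
  have v: "norm v = 1" "norm x *\<^sub>R v = x" using x by (simp_all add: v_def)
  have "u (t *\<^sub>R e) = u (t *\<^sub>R v)" for t
    using rad v(1) e unfolding radially_symmetric_def by simp
  then have "((\<lambda>t. u (t *\<^sub>R v)) has_real_derivative gradient u (norm x *\<^sub>R e) \<bullet> e) (at (norm x))"
    using DERIV_along_ray[OF u, of e "norm x"] by simp
  from DERIV_unique[OF this DERIV_along_ray[OF u]]
  have "gradient u (norm x *\<^sub>R e) \<bullet> e = gradient u x \<bullet> v"
    by (simp add: v(2))
  then show ?thesis
    using Cauchy_Schwarz_ineq2[of "gradient u x" v] v by simp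
qed

text \<open>The fundamental theorem of calculus along the ray, from \<open>s\<close> to a point
  beyond the support.\<close>

lemma abs_le_nn_integral_radial_derivative:
  fixes u :: "real ^ 'n::finite \<Rightarrow> real"
  assumes u: "u \<in> test_functions" and e: "norm e = 1"
  shows "ennreal \<bar>u (s *\<^sub>R e)\<bar> \<le> (\<integral>\<^sup>+t. ennreal \<bar>gradient u (t *\<^sub>R e) \<bullet> e\<bar> * indicator {s..} t \<partial>lborel)"
proof -
  obtain R where R: "R > 0" "\<And>x. norm x > R \<Longrightarrow> u x = 0"
    using test_functions_bounded_support[OF u] by blast
  \<comment> \<open>The maximum ensures both \<open>s \<le> b\<close> and that
    \<open>b *\<^sub>R e\<close> lies outside the ball containing the support.\<close>
  define b where "b = max s (R + 1)"
  have "u (b *\<^sub>R e) = 0" using R e by (intro R(2)) (auto simp: b_def)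
  have cont: "continuous_on A (\<lambda>t. gradient u (t *\<^sub>R e) \<bullet> e)" for A
    by (intro continuous_intros continuous_on_compose2[OF test_functions_continuous_gradient[OF u]]) auto
  have *: "has_bochner_integral lborel (\<lambda>t. indicator {s..b} t *\<^sub>R (gradient u (t *\<^sub>R e) \<bullet> e)) (u (b *\<^sub>R e) - u (s *\<^sub>R e))"
    by (rule has_bochner_integral_FTC_Icc[where F = "\<lambda>t. u (t *\<^sub>R e)"])
       (auto simp: b_def simp flip: has_real_derivative_iff_has_vector_derivative
         intro!: has_field_derivative_at_within DERIV_along_ray[OF u] cont)
  have "ennreal \<bar>u (s *\<^sub>R e)\<bar> = ennreal (norm (LINT t|lborel. indicator {s..b} t *\<^sub>R (gradient u (t *\<^sub>R e) \<bullet> e)))"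
    using has_bochner_integral_integral_eq[OF *] \<open>u (b *\<^sub>R e) = 0\<close> by simp
  also have "\<dots> \<le> (\<integral>\<^sup>+t. ennreal (norm (indicator {s..b} t *\<^sub>R (gradient u (t *\<^sub>R e) \<bullet> e))) \<partial>lborel)"
    using * by (intro integral_norm_bound_ennreal) (auto simp: has_bochner_integral_iff)
  also have "\<dots> \<le> (\<integral>\<^sup>+t. ennreal \<bar>gradient u (t *\<^sub>R e) \<bullet> e\<bar> * indicator {s..} t \<partial>lborel)"
    by (intro nn_integral_mono) (auto split: split_indicator)
  finally show ?thesis .
qed

section \<open>Decay, Hardy and interpolation estimates for radial functions\<close>

text \<open>The one-dimensional inequalities for the profile along a fixed unit vector, carried over
  by polar coordinates. The sphere area \<open>c\<close> enters the pointwise bound but cancels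
  between the two integrals. \<open>M\<close> is any real upper bound; the value 0 is allowed and
  shows that a vanishing gradient norm forces \<open>u\<close> to vanish off the origin.\<close>

lemma radial_hardy:
  fixes u :: "real ^ 'n::finite \<Rightarrow> real" and p d :: real
  defines "n \<equiv> real CARD('n)"
  defines "c \<equiv> n * unit_ball_vol n"
  assumes u: "u \<in> test_functions" and rad: "radially_symmetric u" and p: "1 \<le> p" and d: "0 < d"
    and \<alpha>: "d = \<alpha> - 1 + n / p"
    and M: "(\<integral>\<^sup>+x. ennreal (norm (norm x powr \<alpha> *\<^sub>R gradient u x) powr p) \<partial>lborel) \<le> ennreal M"
    and M0: "0 \<le> M"
  shows "x \<noteq> 0 \<Longrightarrow> \<bar>u x\<bar> powr p * norm x powr (d * p) \<le> d powr (1 - p) / c * M"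
    and "(\<integral>\<^sup>+x. ennreal (\<bar>u x\<bar> powr p * norm x powr (d * p - n)) \<partial>lborel) \<le> ennreal (d powr (-p) * M)"
proof -
  obtain e :: "real ^ 'n" where e: "norm e = 1"
    using norm_axis_1 by blast
  define h where "h t = \<bar>gradient u (t *\<^sub>R e) \<bullet> e\<bar>" for t
  define F where "F t = \<bar>u (t *\<^sub>R e)\<bar>" for t
  have "continuous_on UNIV F"
    unfolding F_def[abs_def]
    by (intro continuous_intros continuous_on_compose2[OF test_functions_continuous[OF u]]) auto
  then have [measurable]: "F \<in> borel_measurable borel"
    by (rule borel_measurable_continuous_onI)
  have "continuous_on UNIV h"
    unfolding h_def[abs_def]
    by (intro continuous_intros continuous_on_compose2[OF test_functions_continuous_gradient[OF u]]) auto
  then have [measurable]: "h \<in> borel_measurable borel"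
    by (rule borel_measurable_continuous_onI)
  have FR: "\<bar>u x\<bar> = F (norm x)" for x
  proof -
    have "norm x = norm (norm x *\<^sub>R e)" using e by simp
    then have "u x = u (norm x *\<^sub>R e)" using rad unfolding radially_symmetric_def by blast
    then show ?thesis by (simp add: F_def)
  qed
  have F: "ennreal (F s) \<le> (\<integral>\<^sup>+t. ennreal (h t) * indicator {s..} t \<partial>lborel)" for s
    unfolding F_def h_def by (rule abs_le_nn_integral_radial_derivative[OF u e])
  have F0: "F t \<ge> 0" and h0: "h t \<ge> 0" for t by (auto simp: F_def h_def)
  have n: "n > 0" by (simp add: n_def)
  then have c: "c > 0" by (simp add: c_def)
  define N where "N = (\<integral>\<^sup>+t. ennreal (h t powr p * t powr ((1 + d) * p - 1)) * indicator {0<..} t \<partial>lborel)"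
  have polar: "(\<integral>\<^sup>+x. g (norm (x::real^'n)) \<partial>lborel) =
      ennreal c * (\<integral>\<^sup>+t. ennreal (t powr (n - 1)) * g t * indicator {0<..} t \<partial>lborel)"
    if [measurable]: "g \<in> borel_measurable borel" for g
    using nn_integral_radial[where 'a = "real^'n", of g] by (simp add: c_def n_def)
  have "ennreal c * N = ennreal c * (\<integral>\<^sup>+t. ennreal (t powr (n - 1)) * ennreal (h t powr p * t powr (\<alpha> * p)) * indicator {0<..} t \<partial>lborel)"
  proof -
    \<comment> \<open>The choice of \<open>d\<close> makes the weight in \<open>N\<close> equal to
      the polar density times the weight of the gradient norm.\<close>
    have "(1 + d) * p - 1 = (n - 1) + \<alpha> * p" using p by (simp add: \<alpha> field_simps)
    then show ?thesis
      unfolding N_def by (simp only: powr_add) (simp add: ennreal_mult mult_ac)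
  qed
  also have "\<dots> = (\<integral>\<^sup>+x. ennreal (h (norm x) powr p * norm (x::real^'n) powr (\<alpha> * p)) \<partial>lborel)"
    by (rule polar[symmetric]) measurable
  also have "\<dots> \<le> (\<integral>\<^sup>+x. ennreal (norm (norm x powr \<alpha> *\<^sub>R gradient u x) powr p) \<partial>lborel)"
  proof (intro nn_integral_mono ennreal_leI)
    fix x :: "real^'n"
    show "h (norm x) powr p * norm x powr (\<alpha> * p) \<le> norm (norm x powr \<alpha> *\<^sub>R gradient u x) powr p"
    proof (cases "x = 0")
      case False
      have "h (norm x) \<le> norm (gradient u x)"
        unfolding h_def by (rule radial_derivative_le_gradient[OF u rad e False])
      then have "h (norm x) powr p \<le> norm (gradient u x) powr p"
        using p h0 by (intro powr_mono2) auto
      then show ?thesis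
        by (simp add: powr_mult powr_powr mult.commute[of "h (norm x) powr p"] mult_left_mono)
    qed simp
  qed
  also note M
  finally have cN: "ennreal c * N \<le> ennreal M" .
  have "N = ennreal (1 / c) * (ennreal c * N)"
    using c by (simp flip: mult.assoc ennreal_mult)
  also have "\<dots> \<le> ennreal (1 / c) * ennreal M"
    by (intro mult_left_mono cN) auto
  finally have N: "N \<le> ennreal (M / c)"
    using c M0 by (simp flip: ennreal_mult)
  show "\<bar>u x\<bar> powr p * norm x powr (d * p) \<le> d powr (1 - p) / c * M" if "x \<noteq> 0"
  proof -
    have "ennreal (F (norm x) powr p * norm x powr (d * p)) \<le> ennreal (d powr (1 - p)) * N"
      unfolding N_def by (rule hardy_sup) (use p d that F F0 h0 in auto)
    also have "\<dots> \<le> ennreal (d powr (1 - p)) * ennreal (M / c)"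
      by (intro mult_left_mono N) auto
    also have "\<dots> = ennreal (d powr (1 - p) / c * M)"
      using c M0 by (simp flip: ennreal_mult)
    finally show ?thesis using c M0 by (simp add: FR)
  qed
  have "(\<integral>\<^sup>+x. ennreal (\<bar>u x\<bar> powr p * norm x powr (d * p - n)) \<partial>lborel)
     = ennreal c * (\<integral>\<^sup>+t. ennreal (t powr (n - 1)) * ennreal (F t powr p * t powr (d * p - n)) * indicator {0<..} t \<partial>lborel)"
    unfolding FR by (rule polar) measurable
  also have "\<dots> = ennreal c * (\<integral>\<^sup>+t. ennreal (F t powr p * t powr (d * p - 1)) * indicator {0<..} t \<partial>lborel)"
  proof -
    have "d * p - 1 = (n - 1) + (d * p - n)" by simp
    then show ?thesis
      by (simp only: powr_add) (simp add: ennreal_mult mult_ac)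
  qed
  also have "\<dots> \<le> ennreal c * (ennreal (d powr (-p)) * N)"
    unfolding N_def by (intro mult_left_mono hardy_integral) (use p d F F0 h0 in auto)
  also have "\<dots> \<le> ennreal (d powr (-p)) * ennreal M"
    using mult_left_mono[OF cN, of "ennreal (d powr (-p))"] by (simp add: mult_ac)
  finally show "(\<integral>\<^sup>+x. ennreal (\<bar>u x\<bar> powr p * norm x powr (d * p - n)) \<partial>lborel) \<le> ennreal (d powr (-p) * M)"
    using M0 by (simp add: ennreal_mult)
qed

text \<open>The integrand is at most a constant times \<open>f powr (1 - t) * g powr t\<close>,
  where \<open>f\<close> is the Hardy integrand and \<open>g\<close> that of the
  \<open>q\<close>-norm. The surplus power \<open>m\<close> of \<open>u\<close> is absorbed by the
  decay estimate, and Hoelder's inequality handles the rest. For \<open>a = 1\<close> one has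
  \<open>t = 0\<close>, so \<open>B\<close> need not bound anything.\<close>

lemma radial_interpolation:
  fixes u :: "real ^ 'n::finite \<Rightarrow> real" and p q r a d \<alpha> \<beta> \<gamma> M B :: real
  defines "n \<equiv> real CARD('n)"
  defines "t \<equiv> (1 - a) * r / q"
  defines "m \<equiv> a * r - p * (1 - t)"
  assumes u: "u \<in> test_functions" and rad: "radially_symmetric u"
    and p: "1 \<le> p" and q: "1 \<le> q" and r: "0 < r" and a: "0 < a" "a \<le> 1"
    and d: "0 < d" "d = \<alpha> - 1 + n / p"
    and scaling: "\<gamma> * r + n = a * r * d + (1 - a) * r * \<beta> + n * t"
    and t: "t \<le> 1" and m: "0 \<le> m"
    and M: "(\<integral>\<^sup>+x. ennreal (norm (norm x powr \<alpha> *\<^sub>R gradient u x) powr p) \<partial>lborel) \<le> ennreal M" "0 < M"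
    and B: "a < 1 \<Longrightarrow> (\<integral>\<^sup>+x. ennreal (norm (norm x powr \<beta> * u x) powr q) \<partial>lborel) \<le> ennreal B" "0 < B"
  shows "(\<integral>\<^sup>+x. ennreal (norm (norm x powr \<gamma> * u x) powr r) \<partial>lborel) \<le>
    ennreal ((d powr (1 - p) / (n * unit_ball_vol n)) powr (m / p) * (d powr (-p)) powr (1 - t)
      * M powr (a * r / p) * B powr t)"
proof -
  have n: "n > 0" by (simp add: n_def)
  define K where "K = d powr (1 - p) / (n * unit_ball_vol n)"
  have K: "K > 0" using d n by (simp add: K_def)
  have t0: "0 \<le> t" using a r q by (simp add: t_def)
  have qt: "q * t = (1 - a) * r" using q by (simp add: t_def)
  note hardy = radial_hardy[OF u rad p d(1) d(2)[unfolded n_def] M(1) less_imp_le[OF M(2)], folded n_def]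
  have [measurable]: "u \<in> borel_measurable borel"
    by (rule borel_measurable_continuous_onI[OF test_functions_continuous[OF u]])
  define f where "f x = \<bar>u x\<bar> powr p * norm x powr (d * p - n)" for x
  define g where "g x = norm (norm x powr \<beta> * u x) powr q" for x
  have [measurable]: "f \<in> borel_measurable borel" "g \<in> borel_measurable borel"
    unfolding f_def[abs_def] g_def[abs_def] by measurable
  have pt: "norm (norm x powr \<gamma> * u x) powr r \<le> (K * M) powr (m / p) * (f x powr (1 - t) * g x powr t)"
    if x: "x \<noteq> 0" for x
  proof (cases "u x = 0")
    case False
    define y z where "y = \<bar>u x\<bar>" and "z = norm x"
    have yz: "y > 0" "z > 0" using False x by (auto simp: y_def z_def)
    \<comment> \<open>The exponents of \<open>u\<close> balance by the definition of
      \<open>m\<close>; those of \<open>norm x\<close>, in \<open>ez\<close>, balance by the scaling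
      identity.\<close>
    have ey: "r = m + (p * (1 - t) + q * t)" by (simp add: m_def qt algebra_simps)
    have "\<beta> * q * t = \<beta> * ((1 - a) * r)" using qt by (simp add: mult.assoc)
    then have ez: "\<gamma> * r = d * m + ((d * p - n) * (1 - t) + \<beta> * q * t)"
      using scaling by (simp add: m_def algebra_simps)
    have "norm (norm x powr \<gamma> * u x) powr r = z powr (\<gamma> * r) * y powr r"
      using yz by (simp add: y_def z_def abs_mult powr_mult powr_powr)
    also have "z powr (\<gamma> * r) = z powr (d * m) * (z powr ((d * p - n) * (1 - t)) * z powr (\<beta> * q * t))"
      unfolding ez powr_add ..
    also have "y powr r = y powr m * (y powr (p * (1 - t)) * y powr (q * t))"
      by (subst ey) (simp only: powr_add)
    also have "z powr (d * m) * (z powr ((d * p - n) * (1 - t)) * z powr (\<beta> * q * t)) *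
        (y powr m * (y powr (p * (1 - t)) * y powr (q * t)))
       = (y powr p * z powr (d * p)) powr (m / p) * (f x powr (1 - t) * g x powr t)"
      using yz p by (simp add: f_def g_def abs_mult powr_mult powr_powr mult_ac flip: y_def z_def)
    also have "\<dots> \<le> (K * M) powr (m / p) * (f x powr (1 - t) * g x powr t)"
      using hardy(1)[OF x] m p unfolding y_def z_def K_def
      by (intro mult_right_mono powr_mono2) auto
    finally show ?thesis .
  qed (use r in simp)
  have "(\<integral>\<^sup>+x. ennreal (norm (norm x powr \<gamma> * u x) powr r) \<partial>lborel)
      \<le> (\<integral>\<^sup>+x. ennreal ((K * M) powr (m / p)) * ennreal (f x powr (1 - t) * g x powr t) \<partial>lborel)"
  proof (rule nn_integral_mono_AE)
    have "AE x in lborel. x \<noteq> (0 :: real^'n)" by (rule AE_lborel_singleton)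
    then show "AE x in lborel. ennreal (norm (norm x powr \<gamma> * u x) powr r)
        \<le> ennreal ((K * M) powr (m / p)) * ennreal (f x powr (1 - t) * g x powr t)"
      by eventually_elim (use pt in \<open>simp add: ennreal_leI flip: ennreal_mult\<close>)
  qed
  also have "\<dots> = ennreal ((K * M) powr (m / p)) * (\<integral>\<^sup>+x. ennreal (f x powr (1 - t) * g x powr t) \<partial>lborel)"
    by (rule nn_integral_cmult) measurable
  also have "\<dots> \<le> ennreal ((K * M) powr (m / p)) * ennreal ((d powr (-p) * M) powr (1 - t) * B powr t)"
  proof (intro mult_left_mono nn_integral_powr_mult_le)
    show "(\<integral>\<^sup>+x. ennreal (f x) \<partial>lborel) \<le> ennreal (d powr (-p) * M)"
      unfolding f_def by (rule hardy(2))
    show "(\<integral>\<^sup>+x. ennreal (g x) \<partial>lborel) \<le> ennreal B" if "0 < t"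
      unfolding g_def by (rule B(1)) (use that r q a in \<open>auto simp: t_def zero_less_mult_iff zero_less_divide_iff\<close>)
  qed (use t t0 d M B in \<open>auto simp: f_def g_def\<close>)
  also have "\<dots> = ennreal (K powr (m / p) * (d powr (-p)) powr (1 - t) * (M powr (m / p) * M powr (1 - t)) * B powr t)"
    using K d M by (simp add: powr_mult mult_ac flip: ennreal_mult)
  \<comment> \<open>The decay estimate contributes \<open>m / p\<close> and the Hardy inequality
    \<open>1 - t\<close> to the power of \<open>M\<close>.\<close>
  also have "M powr (m / p) * M powr (1 - t) = M powr (a * r / p)"
    using p by (simp add: m_def field_simps flip: powr_add)
  finally show ?thesis by (simp add: K_def)
qed

section \<open>Extended-valued powers and vanishing norms\<close>

lemma ennreal_powr_ennreal:
  assumes "0 \<le> x" "s \<noteq> 0"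
  shows "ennreal_powr (ennreal x) s = ennreal (x powr s)"
  using assms by (simp add: ennreal_powr_def)

lemma ennreal_powr_mono:
  assumes "x \<le> y" "0 \<le> s"
  shows "ennreal_powr x s \<le> ennreal_powr y s"
proof (cases "y = \<infinity>")
  case False
  with assms(1) have "x < \<infinity>" "y < \<infinity>" by (auto simp: less_top intro: order.strict_trans1)
  with assms show ?thesis
    by (auto simp: ennreal_powr_def intro!: ennreal_leI powr_mono2 enn2real_mono)
qed (simp add: ennreal_powr_def)

lemma ennreal_powr_0_left: "s \<noteq> 0 \<Longrightarrow> ennreal_powr 0 s = 0"
  by (simp add: ennreal_powr_def)

lemma ennreal_powr_top: "s \<noteq> 0 \<Longrightarrow> ennreal_powr top s = top"
  by (simp add: ennreal_powr_def)

lemma ennreal_powr_eq_0_iff: "ennreal_powr x s = 0 \<longleftrightarrow> s \<noteq> 0 \<and> x = 0"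
  by (cases x) (auto simp: ennreal_powr_def ennreal_eq_0_iff powr_eq_0_iff)

lemma Lp_norm_eq_0_AE:
  fixes u :: "real ^ 'n::finite \<Rightarrow> real"
  assumes "0 < r" "AE x in lborel. u x = 0"
  shows "Lp_norm r (\<lambda>x. norm x powr \<gamma> * u x) = 0"
proof -
  have "(\<integral>\<^sup>+x. ennreal (norm (norm x powr \<gamma> * u x) powr r) \<partial>lborel) = (\<integral>\<^sup>+x. 0 \<partial>(lborel :: (real^'n) measure))"
    using assms(2) by (intro nn_integral_cong_AE) (auto elim!: eventually_mono)
  with assms(1) show ?thesis
    by (simp add: Lp_norm_def ennreal_powr_0_left)
qed

text \<open>Off the origin the weight is positive, so the integrand vanishes only where
  \<open>u\<close> does.\<close>

lemma AE_eq_0_of_weighted_integral_eq_0: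
  fixes u :: "real ^ 'n::finite \<Rightarrow> real"
  assumes [measurable]: "u \<in> borel_measurable borel"
    and "(\<integral>\<^sup>+x. ennreal (norm (norm x powr \<beta> * u x) powr q) \<partial>lborel) = 0"
  shows "AE x in lborel. u x = 0"
proof -
  have "AE x in lborel. ennreal (norm (norm x powr \<beta> * u x) powr q) = 0"
    using assms(2) by (subst (asm) nn_integral_0_iff_AE) auto
  moreover have "AE x in lborel. x \<noteq> (0 :: real^'n)" by (rule AE_lborel_singleton)
  ultimately show ?thesis
    by eventually_elim (auto simp: ennreal_eq_0_iff)
qed

section \<open>The weighted inequality, from the interpolation estimate\<close>

theorem theorem1p1:
  fixes p q r a \<alpha> \<beta> \<gamma> \<sigma> n :: real
  assumes n_def: "n = real CARD('n::finite)"
    and "p \<ge> 1" and "q \<ge> 1" and "r > 0" and "0 \<le> a" and "a \<le> 1"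
    and "1 / p + \<alpha> / n > 0" and "1 / q + \<beta> / n > 0" and "1 / r + \<gamma> / n > 0"
    and "\<gamma> = a * \<sigma> + (1 - a) * \<beta>"
    and "1 / r + \<gamma> / n = a * (1 / p + (\<alpha> - 1) / n) + (1 - a) * (1 / q + \<beta> / n)"
    and "(1 - a) / q \<le> 1 / r" and "1 / r \<le> a / p + (1 - a) / q"
    and "a > 0 \<Longrightarrow> (n - 1) * (1 / a * (1 / r - 1 / q) + 1 / q - 1 / p) \<le> \<alpha> - \<sigma>"
    and "a > 0 \<Longrightarrow> p = 1 \<Longrightarrow> (n - 1) * (1 / a * (1 / r - 1 / q) + 1 / q - 1 / p) < \<alpha> - \<sigma>"
    and "a > 0 \<Longrightarrow> \<alpha> - \<sigma> \<le> 0"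
    and "a > 0 \<Longrightarrow> - \<sigma> / n < 1 / a * (1 / r - 1 / q) + 1 / q"
  shows "\<exists>C::real. C > 0 \<and>
    (\<forall>u :: real ^ 'n \<Rightarrow> real. u \<in> test_functions \<longrightarrow> radially_symmetric u \<longrightarrow>
       Lp_norm r (\<lambda>x. norm x powr \<gamma> * u x)
         \<le> ennreal C
            * ennreal_powr (Lp_norm p (\<lambda>x. norm x powr \<alpha> *\<^sub>R gradient u x)) a
            * ennreal_powr (Lp_norm q (\<lambda>x. norm x powr \<beta> * u x)) (1 - a))"
proof (cases "a = 0")
  case True
  \<comment> \<open>Both bounds on \<open>1 / r\<close> become \<open>1 / q\<close>. The gradient
    factor is 1 by convention, the two sides coincide and the constant 1 works.\<close>
  then have "1 / q = 1 / r" "\<gamma> = \<beta>" using assms by auto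
  then have "r = q" "\<gamma> = \<beta>" by auto
  then show ?thesis
    using True by (intro exI[of _ 1]) (auto simp: ennreal_powr_def less_top ennreal_enn2real_if)
next
  case False
  with assms have a: "0 < a" by simp
  note p = \<open>p \<ge> 1\<close> and q = \<open>q \<ge> 1\<close> and r = \<open>r > 0\<close>
  have n: "n > 0" by (simp add: n_def)
  define d where "d = \<alpha> - 1 + n / p"
  define t where "t = (1 - a) * r / q"
  define m where "m = a * r - p * (1 - t)"
  have dn: "d = n * (1 / p + (\<alpha> - 1) / n)" using n by (simp add: d_def field_simps)
  have d: "d > 0"
  proof -
    \<comment> \<open>The last hypothesis multiplied by \<open>a * n\<close>. Inserting the formula
      for \<open>\<gamma>\<close> eliminates \<open>\<sigma>\<close>, and the dimensional balance
      identifies the result as \<open>a * d\<close>.\<close>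
    have "0 < a * (n * (\<sigma> / n + (1 / a * (1 / r - 1 / q) + 1 / q)))"
      using assms(17)[OF a] a n by (intro mult_pos_pos) auto
    also have "\<dots> = n * (1 / r + \<gamma> / n - (1 - a) * (1 / q + \<beta> / n))"
      using a n by (simp add: \<open>\<gamma> = _\<close> divide_simps) (simp add: algebra_simps)
    also have "\<dots> = a * d"
      unfolding assms(11) dn by (simp add: algebra_simps)
    finally show ?thesis using a by (simp add: zero_less_mult_iff)
  qed
  have scaling: "\<gamma> * r + n = a * r * d + (1 - a) * r * \<beta> + n * t"
  proof -
    have "\<gamma> * r + n = n * r * (1 / r + \<gamma> / n)" using n r by (simp add: field_simps)
    also have "\<dots> = n * r * (a * (d / n) + (1 - a) * (1 / q + \<beta> / n))"
      unfolding assms(11) dn using n by simp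
    also have "\<dots> = a * r * d + (1 - a) * r * \<beta> + n * t"
      using n by (simp add: t_def algebra_simps add_divide_distrib diff_divide_distrib)
    finally show ?thesis .
  qed
  \<comment> \<open>The lower and upper bounds on \<open>1 / r\<close> amount to
    \<open>t \<le> 1\<close> and \<open>0 \<le> m\<close> respectively.\<close>
  have t: "t \<le> 1"
    using mult_right_mono[OF assms(12) less_imp_le[OF r]] r by (simp add: t_def)
  have "1 \<le> (a / p + (1 - a) / q) * r"
    using mult_right_mono[OF assms(13) less_imp_le[OF r]] r by simp
  then have "1 \<le> a * r / p + t" by (simp add: t_def algebra_simps)
  then have m: "0 \<le> m" using p by (simp add: m_def field_simps)
  define K where "K = (d powr (1 - p) / (n * unit_ball_vol n)) powr (m / p) * (d powr (-p)) powr (1 - t)"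
  have "unit_ball_vol n > 0" using n by simp
  then have K: "K > 0" using d n by (simp add: K_def less_le)
  have "Lp_norm r (\<lambda>x. norm x powr \<gamma> * u x)
         \<le> ennreal (K powr (1 / r))
            * ennreal_powr (Lp_norm p (\<lambda>x. norm x powr \<alpha> *\<^sub>R gradient u x)) a
            * ennreal_powr (Lp_norm q (\<lambda>x. norm x powr \<beta> * u x)) (1 - a)" (is "?L \<le> _ * ?P * ?Q")
    if u: "u \<in> test_functions" and rad: "radially_symmetric u" for u :: "real ^ 'n \<Rightarrow> real"
  \<comment> \<open>Unless \<open>u\<close> vanishes almost everywhere, both factors on the right
    are nonzero. Hence an infinite factor makes the whole right side infinite, and no product of 0
    and \<open>\<infinity>\<close> arises.\<close>
  proof (cases "AE x in lborel. u x = 0")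
    case True
    then show ?thesis by (simp add: Lp_norm_eq_0_AE r)
  next
    case nz: False
    have [measurable]: "u \<in> borel_measurable borel"
      by (rule borel_measurable_continuous_onI[OF test_functions_continuous[OF u]])
    define MM where "MM = (\<integral>\<^sup>+x. ennreal (norm (norm x powr \<alpha> *\<^sub>R gradient u x) powr p) \<partial>lborel)"
    define BB where "BB = (\<integral>\<^sup>+x. ennreal (norm (norm x powr \<beta> * u x) powr q) \<partial>lborel)"
    have P: "?P = ennreal_powr (ennreal_powr MM (1 / p)) a"
      and Q: "?Q = ennreal_powr (ennreal_powr BB (1 / q)) (1 - a)"
      by (simp_all add: Lp_norm_def MM_def BB_def)
    have BB: "BB \<noteq> 0"
      using nz AE_eq_0_of_weighted_integral_eq_0[of u \<beta> q] by (auto simp: BB_def)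
    have MM: "MM \<noteq> 0"
    proof
      assume "MM = 0"
      \<comment> \<open>The decay estimate with the bound 0 in place of \<open>M\<close>.\<close>
      then have "u x = 0" if "x \<noteq> 0" for x
        using radial_hardy(1)[OF u rad p d d_def[unfolded n_def], of 0 x] that
        by (simp add: MM_def mult_le_0_iff powr_eq_0_iff)
      then have "AE x in lborel. u x = 0"
        using AE_lborel_singleton[of 0] by (auto elim!: eventually_mono)
      with nz show False ..
    qed
    have "?P \<noteq> 0" "?Q \<noteq> 0" by (auto simp: P Q ennreal_powr_eq_0_iff MM BB)
    show ?thesis
    proof (cases "MM = \<infinity> \<or> a < 1 \<and> BB = \<infinity>")
      case True
      then have "?P = \<infinity> \<or> ?Q = \<infinity>" using p q a by (auto simp: P Q ennreal_powr_top)
      with \<open>?P \<noteq> 0\<close> \<open>?Q \<noteq> 0\<close> K show ?thesis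
        by (auto simp: ennreal_mult_eq_top_iff ennreal_mult_top ennreal_top_mult)
    next
      case False
      obtain M where M: "MM = ennreal M" "M > 0"
        using False MM by (cases MM) (auto simp: ennreal_eq_0_iff)
      \<comment> \<open>For \<open>a = 1\<close> the integral \<open>BB\<close> may be infinite; any
        positive \<open>B\<close> then serves, as its exponent \<open>t\<close> is 0.\<close>
      obtain B where B: "a < 1 \<Longrightarrow> BB = ennreal B" "B > 0"
        using False BB by (cases BB; cases "a < 1") (auto simp: ennreal_eq_0_iff intro: that[of 1])
      have "MM \<le> ennreal M" and "a < 1 \<Longrightarrow> BB \<le> ennreal B" using M B by auto
      note radial_interpolation[OF u rad p q r a \<open>a \<le> 1\<close> d d_def[unfolded n_def]
          scaling[unfolded t_def n_def] t[unfolded t_def] m[unfolded m_def t_def]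
          this(1)[unfolded MM_def] M(2) this(2)[unfolded BB_def] B(2)]
      then have "?L \<le> ennreal_powr (ennreal (K * M powr (a * r / p) * B powr t)) (1 / r)"
        unfolding Lp_norm_def K_def t_def m_def n_def
        by (rule ennreal_powr_mono) (use r in auto)
      also have "\<dots> = ennreal (K powr (1 / r) * M powr (a / p) * B powr (t / r))"
        using K M B r by (simp add: ennreal_powr_ennreal powr_mult powr_powr)
      also have "\<dots> = ennreal (K powr (1 / r)) * ennreal (M powr (a / p)) * ennreal (B powr (t / r))"
        by (simp add: ennreal_mult)
      also have "ennreal (M powr (a / p)) = ?P"
        using M p a by (simp add: P ennreal_powr_ennreal powr_powr)
      also have "ennreal (B powr (t / r)) = ?Q"
      \<comment> \<open>In general \<open>t / r = (1 - a) / q\<close>. For \<open>a = 1\<close> both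
        sides are 1, the right one by the convention for the exponent 0.\<close>
      proof (cases "a = 1")
        case True
        with B show ?thesis by (simp add: t_def ennreal_powr_def)
      next
        case False
        with B q r \<open>a \<le> 1\<close> show ?thesis
          by (simp add: Q t_def ennreal_powr_ennreal powr_powr)
      qed
      finally show ?thesis .
    qed
  qed
  then show ?thesis using K by (intro exI[of _ "K powr (1 / r)"]) auto
qed

end
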